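(* Let $1\le N\le M$ be integers, let $\overline{\lambda}=(\overline{\lambda_1}\ge\cdots\ge\overline{\lambda_N}\ge 0)$ be a Young diagram with $\overline{\lambda_1}\le M-N$, let $z_1,\dots,z_N$ be free variables and $t$ a nonzero free parameter. Then $$t^{N(M-N)}\prod_{1\le j<k\le N}(z_j+tz_k)\,s_{\overline{\lambda}}\Big(\frac{z_1}{t},\dots,\frac{z_N}{t}\Big)= \sum_{\overline{\mathcal T}}\overline{G}(\overline{\mathcal T},\{z\}_N),$$ where $$\overline{G}(\overline{\mathcal T},\{z\}_N)=\Big(\prod_{i=0}^{N-1}\prod_{j=i}^{N-1}\overline{\gamma}(\overline{a_{i,j}})\Big) z_N^{d_0(\overline{\mathcal T})-d_1(\overline{\mathcal T})}z_{N-1}^{d_1(\overline{\mathcal T})-d_2(\overline{\mathcal T})}\cdots z_2^{d_{N-2}(\overline{\mathcal T})-d_{N-1}(\overline{\mathcal T})}z_1^{d_{N-1}(\overline{\mathcal T})}$$ and the sum is over all strict (dual) Gelfand-Tsetlin patterns $\overline{\mathcal T}=(\overline{a_{i,j}})_{0\le i\le j\le N-1}$ whose bottom row is $\overline{a_{0,j}}=\overline{\lambda_{j+1}}+N-j-1$, $j=0,\dots,N-1$.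
   Context: The Schur polynomial for $\lambda=(\lambda_1\ge\cdots\ge\lambda_N\ge0)$ is $s_\lambda(z_1,\dots,z_N)=\det_{1\le j,k\le N}(z_j^{\lambda_k+N-k})/\prod_{1\le j<k\le N}(z_j-z_k)$. A strict (dual) Gelfand-Tsetlin pattern is an array of integers $\overline{\mathcal T}=(\overline{a_{i,j}})_{0\le i\le j\le N-1}$ whose $i$-th row (counted from the bottom, starting from $i=0$) is $\overline{a_{i,i}},\dots,\overline{a_{i,N-1}}$, such that the rows interlace, $\overline{a_{i-1,j-1}}\ge\overline{a_{i,j}}\ge\overline{a_{i-1,j}}$ for $1\le i\le j\le N-1$, and each row is strictly decreasing: $\overline{a_{i,i}}>\overline{a_{i,i+1}}>\cdots>\overline{a_{i,N-1}}$. One also sets $\overline{a_{j,j-1}}=M$ for $j=1,\dots,N$. Put $d_j(\overline{\mathcal T})=\sum_{k=j}^{N-1}\overline{a_{j,k}}$, $j=0,\dots,N-1$. For $0\le i\le j\le N-1$, $$\overline{\gamma}(\overline{a_{i,j}})=t^{\max(\overline{a_{i+1,j}}-\overline{a_{i,j}}-1,\,0)}\times c_{i,j},$$ where $c_{i,j}=t+1$ if $i\ge1$ and $\overline{a_{i-1,j}}\ne\overline{a_{i,j}}\ne\overline{a_{i-1,j-1}}$, and $c_{i,j}=1$ otherwise (in particular $c_{0,j}=1$). *)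

theory Defs
  imports "HOL-Library.Poly_Mapping" "Jordan_Normal_Form.Determinant"
begin

text \<open>
  Multivariate polynomials in variables indexed by the natural numbers are finitely supported
  maps from monomials (finitely supported exponent vectors) to coefficients.
\<close>

type_synonym 'a mpoly = "(nat \<Rightarrow>\<^sub>0 nat) \<Rightarrow>\<^sub>0 'a"

definition var :: "nat \<Rightarrow> 'a::comm_ring_1 mpoly" where
  "var i = Poly_Mapping.single (Poly_Mapping.single i 1) 1"

definition eval_mpoly :: "(nat \<Rightarrow> 'a::comm_ring_1) \<Rightarrow> 'a mpoly \<Rightarrow> 'a" where
  "eval_mpoly z p =
     (\<Sum>m\<in>Poly_Mapping.keys p.
        Poly_Mapping.lookup p m * (\<Prod>i\<in>Poly_Mapping.keys m. z i ^ Poly_Mapping.lookup m i))"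

text \<open>
  The quotient of determinants that defines the Schur polynomial is the exact quotient in the
  polynomial ring (an integral domain when the coefficients form a field, so the quotient is
  unique).  As a polynomial it can be evaluated at every point, including points with coinciding
  coordinates. Variables and parts of the partition are numbered from 1; matrix indices start
  from 0, whence the \<open>Suc\<close>.
\<close>

definition schur :: "nat \<Rightarrow> (nat \<Rightarrow> nat) \<Rightarrow> 'a::field mpoly" where
  "schur N lam =
     (THE s. s * (\<Prod>k=1..N. \<Prod>j=1..<k. var j - var k) =
             det (mat N N (\<lambda>(j, k). var (Suc j) ^ (lam (Suc k) + (N - Suc k)))))"

definition young_diagram :: "nat \<Rightarrow> (nat \<Rightarrow> nat) \<Rightarrow> bool" where
  "young_diagram N lam \<longleftrightarrow> (\<forall>j k. 1 \<le> j \<and> j \<le> k \<and> k \<le> N \<longrightarrow> lam k \<le> lam j)"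

text \<open>
  An array indexed by \<open>0 \<le> i \<le> j \<le> N - 1\<close> is a function that vanishes outside this index
  range, so that distinct functions are distinct arrays.
\<close>

definition strict_gt_pattern :: "nat \<Rightarrow> (nat \<Rightarrow> nat \<Rightarrow> int) \<Rightarrow> bool" where
  "strict_gt_pattern N a \<longleftrightarrow>
     (\<forall>i j. \<not> (i \<le> j \<and> j < N) \<longrightarrow> a i j = 0) \<and>
     (\<forall>i j. 1 \<le> i \<and> i \<le> j \<and> j < N \<longrightarrow> a (i - 1) (j - 1) \<ge> a i j \<and> a i j \<ge> a (i - 1) j) \<and>
     (\<forall>i j. i \<le> j \<and> Suc j < N \<longrightarrow> a i j > a i (Suc j))"

definition strict_gt_patterns :: "nat \<Rightarrow> (nat \<Rightarrow> nat) \<Rightarrow> (nat \<Rightarrow> nat \<Rightarrow> int) set" where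
  "strict_gt_patterns N lam =
     {a. strict_gt_pattern N a \<and> (\<forall>j<N. a 0 j = int (lam (j + 1)) + int N - int j - 1)}"

text \<open>The convention \<open>a\<^bsub>j,j-1\<^esub> = M\<close> for \<open>j = 1, \<dots>, N\<close>.\<close>

definition entry :: "nat \<Rightarrow> (nat \<Rightarrow> nat \<Rightarrow> int) \<Rightarrow> nat \<Rightarrow> nat \<Rightarrow> int" where
  "entry M a i j = (if i = Suc j then int M else a i j)"

definition gamma_bar :: "nat \<Rightarrow> 'a::field \<Rightarrow> (nat \<Rightarrow> nat \<Rightarrow> int) \<Rightarrow> nat \<Rightarrow> nat \<Rightarrow> 'a" where
  "gamma_bar M t a i j =
     t powi (max (entry M a (i + 1) j - entry M a i j - 1) 0) *
     (if i \<ge> 1 \<and> a (i - 1) j \<noteq> a i j \<and> a i j \<noteq> a (i - 1) (j - 1) then t + 1 else 1)"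

definition row_sum :: "nat \<Rightarrow> (nat \<Rightarrow> nat \<Rightarrow> int) \<Rightarrow> nat \<Rightarrow> int" where
  "row_sum N a j = (\<Sum>k=j..N-1. a j k)"

definition G_bar ::
    "nat \<Rightarrow> nat \<Rightarrow> 'a::field \<Rightarrow> (nat \<Rightarrow> 'a) \<Rightarrow> (nat \<Rightarrow> nat \<Rightarrow> int) \<Rightarrow> 'a" where
  "G_bar N M t z a =
     (\<Prod>i=0..N-1. \<Prod>j=i..N-1. gamma_bar M t a i j) *
     ((\<Prod>i<N-1. z (N - i) powi (row_sum N a i - row_sum N a (i + 1))) *
      z 1 powi row_sum N a (N - 1))"

end

theory Submission
  imports Defs
begin

text \<open>
  With \<open>z\<^sub>j = t x\<^sub>j\<close> the claim says that the generating function \<open>F\<^sub>N(\<mu>)\<close> of the strict patterns with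
  bottom row \<open>\<mu>\<^sub>j = \<lambda>\<^sub>j + N - j\<close> satisfies
  \<open>\<Delta>\<^sub>N(x) F\<^sub>N(\<mu>) = t\<^bsup>N(M-N)\<^esup> (\<Prod>j<k. t x\<^sub>j + t\<^sup>2 x\<^sub>k) det(x\<^sub>i\<^bsup>\<mu>\<^sub>j\<^esup>)\<close>, where \<open>\<Delta>\<^sub>N\<close> is the Vandermonde product.
  This holds over every commutative ring, by induction on \<open>N\<close>: removing the bottom row expresses
  \<open>F\<^sub>N(\<mu>)\<close> as a sum over the rows \<open>\<nu>\<close> interlacing with \<open>\<mu>\<close>.  Non-strict \<open>\<nu>\<close> may be included because
  their alternants vanish, and then multilinearity of the determinant turns the sum into a single
  determinant.  Each of its entries is a sum of geometric type, and its product with \<open>x\<^sub>i - x\<^sub>N\<close> is,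
  up to a power of \<open>t\<close>, \<open>x\<^sub>i + t x\<^sub>N\<close> times an entry of the matrix \<open>(x\<^sub>i\<^bsup>\<mu>\<^sub>j\<^esup>)\<close> after the column operations that clear
  its last row.  The theorem follows by taking the \<open>x\<^sub>j\<close> to be indeterminates, cancelling \<open>\<Delta>\<^sub>N\<close> in
  the polynomial ring and evaluating at \<open>z\<^sub>j / t\<close>; thus neither the size of the field nor
  coincidences among the \<open>z\<^sub>j\<close> matter.
\<close>

section \<open>Alternants, the Vandermonde product and expansion of determinants\<close>

definition alternant :: "nat \<Rightarrow> (nat \<Rightarrow> 'a::comm_ring_1) \<Rightarrow> (nat \<Rightarrow> nat) \<Rightarrow> 'a" where
  "alternant n x \<mu> = det (mat n n (\<lambda>(i, j). x i ^ \<mu> j))"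

definition vandermonde :: "nat \<Rightarrow> (nat \<Rightarrow> 'a::comm_ring_1) \<Rightarrow> 'a" where
  "vandermonde n x = (\<Prod>k<n. \<Prod>j<k. x j - x k)"

lemma vandermonde_Suc:
  "vandermonde (Suc n) x = vandermonde n x * (\<Prod>i<n. x i - x n)"
  by (simp add: vandermonde_def)

lemma alternant_repeated:
  assumes "i < j" "j < n" "\<mu> i = \<mu> j"
  shows "alternant n x \<mu> = 0"
  unfolding alternant_def
  by (rule det_identical_columns[of _ n i j]) (use assms in auto)

lemma det_scale_rows:
  fixes c :: "nat \<Rightarrow> 'a::comm_ring_1"
  shows "det (mat n n (\<lambda>(i, j). c i * h i j)) = (\<Prod>i<n. c i) * det (mat n n (\<lambda>(i, j). h i j))"
proof -
  have "det (mat n n (\<lambda>(i, j). c i * h i j)) =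
      (\<Sum>p | p permutes {0..<n}. signof p * (\<Prod>i = 0..<n. c i * h i (p i)))"
    by (subst det_def'[of _ n]) (auto intro!: sum.cong prod.cong simp: permutes_in_image
        dest: permutes_in_image)
  also have "\<dots> = (\<Sum>p | p permutes {0..<n}. (\<Prod>i<n. c i) * (signof p * (\<Prod>i = 0..<n. h i (p i))))"
    by (simp add: prod.distrib atLeast0LessThan mult_ac)
  also have "\<dots> = (\<Prod>i<n. c i) * det (mat n n (\<lambda>(i, j). h i j))"
    by (subst det_def'[of _ n]) (auto intro!: sum.cong prod.cong simp: sum_distrib_left permutes_in_image
        dest: permutes_in_image)
  finally show ?thesis .
qed

lemma det_scale_columns:
  fixes c :: "nat \<Rightarrow> 'a::comm_ring_1"
  shows "det (mat n n (\<lambda>(i, j). c j * h i j)) = (\<Prod>j<n. c j) * det (mat n n (\<lambda>(i, j). h i j))"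
proof -
  have transpose: "det (mat n n (\<lambda>(i, j). f j i)) = det (mat n n (\<lambda>(i, j). f i j))"
    for f :: "nat \<Rightarrow> nat \<Rightarrow> 'a"
  proof -
    have "mat n n (\<lambda>(i, j). f j i) = transpose_mat (mat n n (\<lambda>(i, j). f i j))"
      by (rule eq_matI) auto
    thus ?thesis by (simp add: det_transpose[of _ n])
  qed
  show ?thesis
    using det_scale_rows[of n c "\<lambda>i j. h j i"] transpose[of "\<lambda>i j. c j * h i j"] transpose[of h]
    by simp
qed

text \<open>Multilinearity: one summand is chosen in every column. Since \<open>f\<close> depends
  only on the column and on the choice, it leaves the determinant; when \<open>g\<close> consists of
  powers, the remaining determinants are alternants.\<close>

lemma det_sum_columns:
  fixes f :: "nat \<Rightarrow> 'b \<Rightarrow> 'a::comm_ring_1"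
  assumes fin: "\<And>j. j < n \<Longrightarrow> finite (I j)"
  shows "det (mat n n (\<lambda>(i, j). \<Sum>v\<in>I j. f j v * g i v)) =
    (\<Sum>\<nu>\<in>PiE {..<n} I. (\<Prod>j<n. f j (\<nu> j)) * det (mat n n (\<lambda>(i, j). g i (\<nu> j))))"
proof -
  have "det (mat n n (\<lambda>(i, j). \<Sum>v\<in>I j. f j v * g i v)) =
     (\<Sum>p | p permutes {0..<n}. signof p * (\<Prod>j<n. \<Sum>v\<in>I j. f j v * g (p j) v))"
    by (subst det_col[of _ n]) (auto intro!: sum.cong prod.cong simp: permutes_in_image
        dest: permutes_in_image)
  also have "\<dots> = (\<Sum>p | p permutes {0..<n}. \<Sum>\<nu>\<in>PiE {..<n} I.
      signof p * (\<Prod>j<n. f j (\<nu> j) * g (p j) (\<nu> j)))"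
    using fin by (subst prod_sum_PiE) (auto simp: sum_distrib_left)
  also have "\<dots> = (\<Sum>\<nu>\<in>PiE {..<n} I. \<Sum>p | p permutes {0..<n}.
      signof p * (\<Prod>j<n. f j (\<nu> j) * g (p j) (\<nu> j)))"
    by (rule sum.swap)
  also have "\<dots> = (\<Sum>\<nu>\<in>PiE {..<n} I. (\<Prod>j<n. f j (\<nu> j)) * det (mat n n (\<lambda>(i, j). g i (\<nu> j))))"
  proof (rule sum.cong[OF refl])
    fix \<nu>
    have "det (mat n n (\<lambda>(i, j). g i (\<nu> j))) =
       (\<Sum>p | p permutes {0..<n}. signof p * (\<Prod>j<n. g (p j) (\<nu> j)))"
      by (subst det_col[of _ n]) (auto intro!: sum.cong prod.cong simp: permutes_in_image
        dest: permutes_in_image)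
    thus "(\<Sum>p | p permutes {0..<n}. signof p * (\<Prod>j<n. f j (\<nu> j) * g (p j) (\<nu> j))) =
      (\<Prod>j<n. f j (\<nu> j)) * det (mat n n (\<lambda>(i, j). g i (\<nu> j)))"
      by (simp add: prod.distrib sum_distrib_left mult_ac)
  qed
  finally show ?thesis .
qed

text \<open>Subtract from each column the multiple of the next one that clears its entry in the last row.\<close>

lemma alternant_reduce:
  assumes dec: "\<And>j. j < n \<Longrightarrow> \<mu> (Suc j) \<le> \<mu> j"
  shows "alternant (Suc n) x \<mu> =
    x n ^ \<mu> n * det (mat n n (\<lambda>(i, j). x i ^ \<mu> j - x n ^ (\<mu> j - \<mu> (Suc j)) * x i ^ \<mu> (Suc j)))"
proof -
  define V where "V = mat (Suc n) (Suc n) (\<lambda>(i, j). x i ^ \<mu> j)"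
  \<comment> \<open>Right multiplication by \<open>E\<close>, lower bidiagonal with unit diagonal,
    performs all the column operations on the original columns at once and leaves the last column
    alone.\<close>
  define E where "E = mat (Suc n) (Suc n)
    (\<lambda>(k, j). if k = j then 1 else if k = Suc j then - (x n ^ (\<mu> j - \<mu> (Suc j))) else 0)"
  define B where "B = mat (Suc n) (Suc n) (\<lambda>(i, j). if j < n
     then x i ^ \<mu> j - x n ^ (\<mu> j - \<mu> (Suc j)) * x i ^ \<mu> (Suc j) else x i ^ \<mu> n)"
  have VE: "V * E = B"
  proof (rule eq_matI)
    fix i j assume "i < dim_row B" "j < dim_col B"
    hence ij: "i < Suc n" "j < Suc n" by (auto simp: B_def)
    have "(V * E) $$ (i, j) = (\<Sum>k<Suc n. x i ^ \<mu> k *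
       (if k = j then 1 else if k = Suc j then - (x n ^ (\<mu> j - \<mu> (Suc j))) else 0))"
      using ij by (simp add: V_def E_def scalar_prod_def atLeast0LessThan)
    also have "\<dots> = (\<Sum>k<Suc n. (if k = j then x i ^ \<mu> k else 0) +
       (if k = Suc j then - (x n ^ (\<mu> j - \<mu> (Suc j)) * x i ^ \<mu> k) else 0))"
      by (intro sum.cong) auto
    also have "\<dots> = B $$ (i, j)"
      using ij by (subst sum.distrib) (auto simp: B_def less_Suc_eq)
    finally show "(V * E) $$ (i, j) = B $$ (i, j)" .
  qed (auto simp: V_def E_def B_def)
  have "det E = prod_list (diag_mat E)"
    by (rule det_lower_triangular[of "Suc n"]) (auto simp: E_def)
  also have "\<dots> = 1"
    by (simp add: prod_list_diag_prod E_def)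
  finally have "det V = det B"
    using det_mult[of V "Suc n" E] VE by (simp add: V_def E_def)
  also have "det B = (\<Sum>j<Suc n. B $$ (n, j) * cofactor B n j)"
    by (rule laplace_expansion_row) (auto simp: B_def)
  also have "\<dots> = B $$ (n, n) * cofactor B n n"
  proof -
    \<comment> \<open>By weak decrease the exponents \<open>\<mu> j - \<mu> (Suc j)\<close> and
      \<open>\<mu> (Suc j)\<close> add up to \<open>\<mu> j\<close>, so the two terms
      cancel.\<close>
    have "B $$ (n, j) = 0" if "j < n" for j
      using that dec[OF that] by (simp add: B_def flip: power_add)
    thus ?thesis by simp
  qed
  also have "mat_delete B n n =
      mat n n (\<lambda>(i, j). x i ^ \<mu> j - x n ^ (\<mu> j - \<mu> (Suc j)) * x i ^ \<mu> (Suc j))"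
    by (rule eq_matI) (auto simp: mat_delete_def B_def)
  hence "B $$ (n, n) * cofactor B n n =
     x n ^ \<mu> n * det (mat n n (\<lambda>(i, j). x i ^ \<mu> j - x n ^ (\<mu> j - \<mu> (Suc j)) * x i ^ \<mu> (Suc j)))"
    by (simp add: cofactor_def B_def flip: power2_eq_square mult_2)
  finally show ?thesis
    by (simp add: alternant_def V_def)
qed

text \<open>After the column reduction each entry of row i is divisible by x_i - x_n; extracting
  these factors leaves a combination of alternants of size \<open>n\<close>, to which induction
  applies. This supplies the quotient that defines the Schur polynomial.\<close>

lemma vandermonde_dvd_alternant:
  assumes "\<And>j. Suc j < n \<Longrightarrow> \<mu> (Suc j) \<le> \<mu> j"
  shows "vandermonde n x dvd alternant n x \<mu>"
  using assms
proof (induction n arbitrary: \<mu>)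
  case 0
  show ?case by (simp add: vandermonde_def)
next
  case (Suc n)
  \<comment> \<open>With a = \<open>\<mu> j\<close> and b = \<open>\<mu> (Suc j)\<close>: exponents
    and coefficients of (x_i^a - x_n^(a-b) x_i^b) / (x_i - x_n), the sum of x_n^(a-1-v) x_i^v over b
    \<le> v < a.\<close>
  let ?I = "\<lambda>j. {\<mu> (Suc j)..<\<mu> j}" and ?c = "\<lambda>j v. x n ^ (\<mu> j - Suc v)"
  have dec: "\<mu> (Suc j) \<le> \<mu> j" if "j < n" for j
    using Suc.prems that by simp
  have factor: "x i ^ \<mu> j - x n ^ (\<mu> j - \<mu> (Suc j)) * x i ^ \<mu> (Suc j) =
      (x i - x n) * (\<Sum>v\<in>?I j. ?c j v * x i ^ v)" if "j < n" for i j
  proof -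
    define d where "d = \<mu> j - \<mu> (Suc j)"
    have d: "\<mu> j = \<mu> (Suc j) + d"
      using dec[OF that] by (simp add: d_def)
    have "(\<Sum>v\<in>?I j. ?c j v * x i ^ v) = x i ^ \<mu> (Suc j) * (\<Sum>k<d. x n ^ (d - Suc k) * x i ^ k)"
      unfolding sum_distrib_left
      by (rule sum.reindex_bij_witness[of _ "\<lambda>k. \<mu> (Suc j) + k" "\<lambda>v. v - \<mu> (Suc j)"])
         (auto simp: d mult_ac add.commute simp flip: power_add mult.assoc)
    hence "(x i - x n) * (\<Sum>v\<in>?I j. ?c j v * x i ^ v) =
        x i ^ \<mu> (Suc j) * ((x i - x n) * (\<Sum>k<d. x n ^ (d - Suc k) * x i ^ k))"
      by (simp only: mult_ac)
    also have "\<dots> = x i ^ \<mu> (Suc j) * (x i ^ d - x n ^ d)"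
      by (simp only: power_diff_sumr2)
    finally show ?thesis
      by (simp add: d power_add right_diff_distrib mult.commute)
  qed
  have "alternant (Suc n) x \<mu> =
     x n ^ \<mu> n * det (mat n n (\<lambda>(i, j). x i ^ \<mu> j - x n ^ (\<mu> j - \<mu> (Suc j)) * x i ^ \<mu> (Suc j)))"
    by (rule alternant_reduce) (rule dec)
  also have "mat n n (\<lambda>(i, j). x i ^ \<mu> j - x n ^ (\<mu> j - \<mu> (Suc j)) * x i ^ \<mu> (Suc j)) =
     mat n n (\<lambda>(i, j). (x i - x n) * (\<Sum>v\<in>?I j. ?c j v * x i ^ v))"
    by (rule eq_matI) (simp_all add: factor)
  also have "x n ^ \<mu> n * det \<dots> = x n ^ \<mu> n * ((\<Prod>i<n. x i - x n) *
     (\<Sum>\<nu>\<in>PiE {..<n} ?I. (\<Prod>j<n. ?c j (\<nu> j)) * alternant n x \<nu>))"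
    by (simp only: det_scale_rows det_sum_columns finite_atLeastLessThan alternant_def)
  finally have *: "alternant (Suc n) x \<mu> = \<dots>" .
  have "vandermonde n x dvd (\<Sum>\<nu>\<in>PiE {..<n} ?I. (\<Prod>j<n. ?c j (\<nu> j)) * alternant n x \<nu>)"
  proof (intro dvd_sum dvd_mult Suc.IH)
    fix \<nu> j assume \<nu>: "\<nu> \<in> PiE {..<n} ?I" and j: "Suc j < n"
    have "\<nu> j \<in> ?I j" "\<nu> (Suc j) \<in> ?I (Suc j)"
      using \<nu> j by (simp_all add: PiE_iff)
    thus "\<nu> (Suc j) \<le> \<nu> j" by auto
  qed
  thus ?case
    unfolding * vandermonde_Suc mult.commute[of "vandermonde n x"]
    by (intro dvd_mult mult_dvd_mono dvd_refl)
qed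

section \<open>Weighted sums over interlacing rows\<close>

text \<open>
  The weight of an entry \<open>v\<close> of a pattern that lies between the neighbours \<open>b \<le> v \<le> a\<close> of the row
  below it, together with the power of \<open>t\<close> contributed by the neighbour \<open>b\<close>.
\<close>

definition gt_weight :: "'a::comm_ring_1 \<Rightarrow> nat \<Rightarrow> nat \<Rightarrow> nat \<Rightarrow> 'a" where
  "gt_weight t a b v = t ^ (v - b - 1) * (if v \<noteq> b \<and> v \<noteq> a then t + 1 else 1)"

text \<open>All terms share the power \<open>t ^ (a - b - 1)\<close>; what remains is the
  coefficient 1 at v = a, t at v = b and 1 + t in between. These are the coefficients of x + t y
  times the geometric sum of y^(a-1-v) x^v over b \<le> v < a, and x - y makes that sum
  telescope.\<close>

lemma gt_weight_sum:
  fixes x y t :: "'a::comm_ring_1"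
  assumes "b < a"
  shows "(x - y) * (\<Sum>v\<in>{b..a}. gt_weight t a b v * (t * y) ^ (a - v) * x ^ v) =
    t ^ (a - b - 1) * (x + t * y) * (x ^ a - y ^ (a - b) * x ^ b)"
proof -
  define d where "d = a - b - 1"
  have a: "a = Suc (b + d)"
    using assms by (simp add: d_def)
  have inner: "(\<Sum>v\<in>{Suc b..<a}. gt_weight t a b v * (t * y) ^ (a - v) * x ^ v) =
     t ^ d * (1 + t) * y * x ^ Suc b * (\<Sum>k<d. y ^ (d - Suc k) * x ^ k)"
    unfolding sum_distrib_left
  proof (rule sum.reindex_bij_witness[of _ "\<lambda>k. Suc b + k" "\<lambda>v. v - Suc b"])
    fix v assume v: "v \<in> {Suc b..<a}"
    define k where "k = v - Suc b"
    define l where "l = d - Suc k"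
    have "v = Suc b + k" "d = Suc (k + l)"
      using v by (auto simp: k_def l_def a)
    thus "t ^ d * (1 + t) * y * x ^ Suc b * (y ^ (d - Suc (v - Suc b)) * x ^ (v - Suc b)) =
      gt_weight t a b v * (t * y) ^ (a - v) * x ^ v"
      by (simp add: gt_weight_def a power_mult_distrib power_add algebra_simps)
  qed (auto simp: a)
  have split: "{b..a} = insert b (insert a {Suc b..<a})"
    using assms by auto
  have "(\<Sum>v\<in>{b..a}. gt_weight t a b v * (t * y) ^ (a - v) * x ^ v) =
     t ^ d * x ^ b * (t * y ^ Suc d + x ^ Suc d + (1 + t) * y * x * (\<Sum>k<d. y ^ (d - Suc k) * x ^ k))"
    unfolding split using assms
    by (simp add: inner) (simp add: gt_weight_def a power_mult_distrib power_add algebra_simps)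
  also have "(x - y) * \<dots> = t ^ d * x ^ b * ((x - y) * (t * y ^ Suc d + x ^ Suc d) +
      (1 + t) * y * x * ((x - y) * (\<Sum>k<d. y ^ (d - Suc k) * x ^ k)))"
    by (simp only: algebra_simps)
  also have "(x - y) * (\<Sum>k<d. y ^ (d - Suc k) * x ^ k) = x ^ d - y ^ d"
    by (rule power_diff_sumr2[symmetric])
  also have "t ^ d * x ^ b * ((x - y) * (t * y ^ Suc d + x ^ Suc d) + (1 + t) * y * x * (x ^ d - y ^ d)) =
     t ^ (a - b - 1) * (x + t * y) * (x ^ a - y ^ (a - b) * x ^ b)"
    by (simp add: a power_add algebra_simps)
  finally show ?thesis .
qed

text \<open>Rows are extensional functions, so each occurs once in a sum. The entry
  \<open>\<nu> j\<close> stands for a_{1,j+1}, whence the neighbours \<open>\<mu> (Suc j)\<close>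
  and \<open>\<mu> j\<close>.\<close>

definition interlacing :: "nat \<Rightarrow> (nat \<Rightarrow> nat) \<Rightarrow> (nat \<Rightarrow> nat) set" where
  "interlacing n \<mu> =
     {\<nu> \<in> PiE {..<n} (\<lambda>j. {\<mu> (Suc j)..\<mu> j}). \<forall>j. Suc j < n \<longrightarrow> \<nu> (Suc j) < \<nu> j}"

text \<open>
  The weighted sum over the strict patterns with bottom row \<open>\<mu>\<close>, by recursion on the rows.  The
  variables are scaled, \<open>z\<^bsub>i+1\<^esub> = t x\<^bsub>i\<^esub>\<close>, so that no division by \<open>t\<close> is needed.
\<close>

fun gt_sum :: "'a::comm_ring_1 \<Rightarrow> nat \<Rightarrow> (nat \<Rightarrow> 'a) \<Rightarrow> nat \<Rightarrow> (nat \<Rightarrow> nat) \<Rightarrow> 'a" where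
  "gt_sum t M x 0 \<mu> = 1"
| "gt_sum t M x (Suc n) \<mu> = (\<Sum>\<nu>\<in>interlacing n \<mu>.
     t ^ (M - \<mu> 0 - 1) * (\<Prod>j<n. gt_weight t (\<mu> j) (\<mu> (Suc j)) (\<nu> j)) *
     (t * x n) ^ (\<mu> n + (\<Sum>j<n. \<mu> j - \<nu> j)) * gt_sum t M x n \<nu>)"

text \<open>Telescoping, with \<open>n\<close> making up for the subtracted ones; it serves to
  balance the powers of t in the induction below.\<close>

lemma strictly_decreasing_sum:
  fixes \<mu> :: "nat \<Rightarrow> nat"
  assumes "\<And>j. j < n \<Longrightarrow> \<mu> (Suc j) < \<mu> j"
  shows "(\<Sum>j<n. \<mu> j - \<mu> (Suc j) - 1) + \<mu> n + n = \<mu> 0"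
  using assms
proof (induction n)
  case (Suc n)
  have "(\<Sum>j<n. \<mu> j - \<mu> (Suc j) - 1) + \<mu> n + n = \<mu> 0" "\<mu> (Suc n) < \<mu> n"
    using Suc by simp_all
  thus ?case by simp
qed simp

text \<open>The factors \<open>t * x j + t * (t * x k)\<close> are z_j + t z_k in the scaled
  variables. Keeping the Vandermonde product on the left avoids division.\<close>

lemma vandermonde_gt_sum:
  fixes t :: "'a::comm_ring_1"
  assumes "n \<le> M" and "\<And>j. Suc j < n \<Longrightarrow> \<mu> (Suc j) < \<mu> j" and "0 < n \<Longrightarrow> \<mu> 0 < M"
  shows "vandermonde n x * gt_sum t M x n \<mu> =
     t ^ (n * (M - n)) * (\<Prod>k<n. \<Prod>j<k. t * x j + t * (t * x k)) * alternant n x \<mu>"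
  using assms
proof (induction n arbitrary: \<mu>)
  case 0
  show ?case by (simp add: vandermonde_def alternant_def)
next
  case (Suc n)
  let ?y = "x n"
  let ?I = "\<lambda>j. {\<mu> (Suc j)..\<mu> j}"
  \<comment> \<open>The exponent of \<open>t * ?y\<close> is distributed over the columns, so that
    \<open>?c j\<close> depends on \<open>\<nu> j\<close> alone, as multilinearity requires;
    \<open>?C\<close> collects what is independent of \<open>\<nu>\<close>.\<close>
  let ?c = "\<lambda>j v. gt_weight t (\<mu> j) (\<mu> (Suc j)) v * (t * ?y) ^ (\<mu> j - v)"
  let ?P = "\<lambda>n. \<Prod>k<n. \<Prod>j<k. t * x j + t * (t * x k)"
  let ?C = "t ^ (M - \<mu> 0 - 1) * (t * ?y) ^ \<mu> n"
  define S where "S = (\<lambda>i j. \<Sum>v\<in>?I j. ?c j v * x i ^ v)"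
  define h where "h = (\<lambda>i j. x i ^ \<mu> j - ?y ^ (\<mu> j - \<mu> (Suc j)) * x i ^ \<mu> (Suc j))"
  define p where "p = (\<lambda>j. t ^ (\<mu> j - \<mu> (Suc j) - 1))"
  define DS where "DS = det (mat n n (\<lambda>(i, j). S i j))"
  define DH where "DH = det (mat n n (\<lambda>(i, j). h i j))"
  have dec: "\<mu> (Suc j) < \<mu> j" if "j < n" for j
    using Suc.prems that by simp
  have mu0: "(\<Sum>j<n. \<mu> j - \<mu> (Suc j) - 1) + \<mu> n + n = \<mu> 0"
    by (rule strictly_decreasing_sum[of n \<mu>, OF dec])
  have IH: "vandermonde n x * gt_sum t M x n \<nu> = t ^ (n * (M - n)) * ?P n * alternant n x \<nu>"
    if "\<nu> \<in> interlacing n \<mu>" for \<nu>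
  proof (rule Suc.IH)
    assume "0 < n"
    hence "\<nu> 0 \<le> \<mu> 0" using that by (auto simp: interlacing_def PiE_iff)
    thus "\<nu> 0 < M" using Suc.prems by simp
  qed (use that Suc.prems in \<open>auto simp: interlacing_def\<close>)
  have "vandermonde n x * gt_sum t M x (Suc n) \<mu> = (\<Sum>\<nu>\<in>interlacing n \<mu>.
     ?C * (\<Prod>j<n. ?c j (\<nu> j)) * (vandermonde n x * gt_sum t M x n \<nu>))"
    by (simp add: sum_distrib_left power_add prod.distrib power_sum mult_ac)
  also have "\<dots> = ?C * (t ^ (n * (M - n)) * ?P n) *
     (\<Sum>\<nu>\<in>interlacing n \<mu>. (\<Prod>j<n. ?c j (\<nu> j)) * alternant n x \<nu>)"
    by (simp add: IH sum_distrib_left mult_ac)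
  also have "(\<Sum>\<nu>\<in>interlacing n \<mu>. (\<Prod>j<n. ?c j (\<nu> j)) * alternant n x \<nu>) =
     (\<Sum>\<nu>\<in>PiE {..<n} ?I. (\<Prod>j<n. ?c j (\<nu> j)) * alternant n x \<nu>)"
  proof (rule sum.mono_neutral_left)
    show "\<forall>\<nu>\<in>PiE {..<n} ?I - interlacing n \<mu>. (\<Prod>j<n. ?c j (\<nu> j)) * alternant n x \<nu> = 0"
    proof
      fix \<nu> assume "\<nu> \<in> PiE {..<n} ?I - interlacing n \<mu>"
      then obtain j where \<nu>: "\<nu> \<in> PiE {..<n} ?I" and j: "Suc j < n" "\<nu> j \<le> \<nu> (Suc j)"
        by (auto simp: interlacing_def not_less)
      \<comment> \<open>Interlacing forces
        \<open>\<nu> (Suc j) \<le> \<mu> (Suc j) \<le> \<nu> j\<close>, so failure of strictness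
        means a repeated exponent.\<close>
      have "\<nu> j \<in> ?I j" "\<nu> (Suc j) \<in> ?I (Suc j)"
        using \<nu> j by (simp_all add: PiE_iff)
      hence "\<nu> j = \<nu> (Suc j)" using j by auto
      thus "(\<Prod>j<n. ?c j (\<nu> j)) * alternant n x \<nu> = 0"
        using alternant_repeated[of j "Suc j" n \<nu> x] j by simp
    qed
  qed (auto intro!: finite_PiE simp: interlacing_def)
  also have "\<dots> = DS"
    by (simp only: DS_def S_def det_sum_columns finite_atLeastAtMost alternant_def)
  finally have 1: "vandermonde n x * gt_sum t M x (Suc n) \<mu> = ?C * (t ^ (n * (M - n)) * ?P n) * DS" .
  have 2: "(\<Prod>i<n. x i - ?y) * DS =
     (\<Prod>i<n. x i + t * ?y) * ((\<Prod>j<n. p j) * DH)"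
  proof -
    \<comment> \<open>The linear factors depend only on the row and \<open>p j\<close> only on the
      column, so all of them can be taken out of the determinants.\<close>
    have "(x i - ?y) * S i j = (x i + t * ?y) * (p j * h i j)" if "j < n" for i j
      using gt_weight_sum[of "\<mu> (Suc j)" "\<mu> j" "x i" ?y t] dec[OF that]
      unfolding S_def p_def h_def by (simp only: mult_ac)
    hence eq: "mat n n (\<lambda>(i, j). (x i - ?y) * S i j) =
        mat n n (\<lambda>(i, j). (x i + t * ?y) * (p j * h i j))"
      by (intro eq_matI) auto
    show ?thesis
      using arg_cong[OF eq, of det] unfolding det_scale_rows[of n "\<lambda>i. x i - ?y" S]
        det_scale_rows[of n "\<lambda>i. x i + t * ?y" "\<lambda>i j. p j * h i j"] det_scale_columns[of n p h]
        DS_def DH_def .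
  qed
  have alternant: "alternant (Suc n) x \<mu> = ?y ^ \<mu> n * DH"
    unfolding DH_def h_def by (rule alternant_reduce) (rule less_imp_le, rule dec)
  have tpow: "t ^ (M - \<mu> 0 - 1) * t ^ \<mu> n * (\<Prod>j<n. p j) = t ^ (M - Suc n)"
  proof -
    have "M - \<mu> 0 - 1 + \<mu> n + (\<Sum>j<n. \<mu> j - \<mu> (Suc j) - 1) = M - Suc n"
      using mu0 Suc.prems by simp
    thus ?thesis
      unfolding p_def by (simp only: flip: power_add power_sum)
  qed
  \<comment> \<open>The surplus \<open>t ^ n\<close> is absorbed by the \<open>n\<close> new factors
    \<open>t * x i + t * (t * ?y)\<close> of the product.\<close>
  have texp: "n * (M - n) + (M - Suc n) = Suc n * (M - Suc n) + n"
  proof -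
    have "M - n = Suc (M - Suc n)" using Suc.prems by simp
    thus ?thesis by simp
  qed
  have 3: "(\<Prod>i<n. t * x i + t * (t * ?y)) = t ^ n * (\<Prod>i<n. x i + t * ?y)"
    by (simp add: prod.distrib flip: distrib_left)
  have "vandermonde (Suc n) x * gt_sum t M x (Suc n) \<mu> =
     (\<Prod>i<n. x i - ?y) * (vandermonde n x * gt_sum t M x (Suc n) \<mu>)"
    by (simp only: vandermonde_Suc mult_ac)
  also have "\<dots> = ?C * (t ^ (n * (M - n)) * ?P n) *
     ((\<Prod>i<n. x i - ?y) * DS)"
    unfolding 1 by (simp only: mult_ac)
  also have "\<dots> = (t ^ (n * (M - n)) * (t ^ (M - \<mu> 0 - 1) * t ^ \<mu> n * (\<Prod>j<n. p j))) *
     ?P n * (\<Prod>i<n. x i + t * ?y) *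
     (?y ^ \<mu> n * DH)"
    unfolding 2 by (simp only: power_mult_distrib mult_ac)
  also have "\<dots> = t ^ (n * (M - n) + (M - Suc n)) * ?P n * (\<Prod>i<n. x i + t * ?y) * alternant (Suc n) x \<mu>"
    unfolding tpow alternant power_add ..
  also have "\<dots> = t ^ (Suc n * (M - Suc n)) * ?P (Suc n) * alternant (Suc n) x \<mu>"
    unfolding texp power_add by (simp add: 3 mult_ac)
  finally show ?case .
qed

section \<open>Patterns and removal of the bottom row\<close>

definition gt_patterns :: "nat \<Rightarrow> (nat \<Rightarrow> nat) \<Rightarrow> (nat \<Rightarrow> nat \<Rightarrow> int) set" where
  "gt_patterns n \<mu> = {a. strict_gt_pattern n a \<and> (\<forall>j<n. a 0 j = int (\<mu> j))}"

text \<open>Shifting both indices of \<open>b\<close> by one preserves the diagonals, and the zeros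
  keep the array zero outside its index range.\<close>

definition add_row :: "nat \<Rightarrow> (nat \<Rightarrow> nat) \<Rightarrow> (nat \<Rightarrow> nat \<Rightarrow> int) \<Rightarrow> nat \<Rightarrow> nat \<Rightarrow> int" where
  "add_row n \<mu> b i j = (case i of
      0 \<Rightarrow> if j \<le> n then int (\<mu> j) else 0
    | Suc i' \<Rightarrow> (case j of 0 \<Rightarrow> 0 | Suc j' \<Rightarrow> b i' j'))"

lemma add_row_simps [simp]:
  "j \<le> n \<Longrightarrow> add_row n \<mu> b 0 j = int (\<mu> j)"
  "n < j \<Longrightarrow> add_row n \<mu> b 0 j = 0"
  "add_row n \<mu> b (Suc i) 0 = 0"
  "add_row n \<mu> b (Suc i) (Suc j) = b i j"
  by (simp_all add: add_row_def)

lemma strict_gt_patternD: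
  assumes "strict_gt_pattern n a"
  shows "\<And>i j. \<not> (i \<le> j \<and> j < n) \<Longrightarrow> a i j = 0"
    and "\<And>i j. i \<le> j \<Longrightarrow> Suc j < n \<Longrightarrow> a (Suc i) (Suc j) \<le> a i j"
    and "\<And>i j. i \<le> j \<Longrightarrow> Suc j < n \<Longrightarrow> a i (Suc j) \<le> a (Suc i) (Suc j)"
    and "\<And>i j. i \<le> j \<Longrightarrow> Suc j < n \<Longrightarrow> a i (Suc j) < a i j"
proof -
  fix i j :: nat
  assume "i \<le> j" "Suc j < n"
  with assms have "a (Suc i - 1) (Suc j - 1) \<ge> a (Suc i) (Suc j) \<and> a (Suc i) (Suc j) \<ge> a (Suc i - 1) (Suc j)"
    unfolding strict_gt_pattern_def by (metis One_nat_def Suc_le_mono le_add1 plus_1_eq_Suc)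
  thus "a (Suc i) (Suc j) \<le> a i j" "a i (Suc j) \<le> a (Suc i) (Suc j)" by simp_all
qed (use assms in \<open>auto simp: strict_gt_pattern_def\<close>)

lemma strict_gt_patternI:
  assumes "\<And>i j. \<not> (i \<le> j \<and> j < n) \<Longrightarrow> a i j = 0"
    and "\<And>i j. i \<le> j \<Longrightarrow> Suc j < n \<Longrightarrow> a (Suc i) (Suc j) \<le> a i j"
    and "\<And>i j. i \<le> j \<Longrightarrow> Suc j < n \<Longrightarrow> a i (Suc j) \<le> a (Suc i) (Suc j)"
    and "\<And>i j. i \<le> j \<Longrightarrow> Suc j < n \<Longrightarrow> a i (Suc j) < a i j"
  shows "strict_gt_pattern n a"
  unfolding strict_gt_pattern_def
proof (intro conjI allI impI)
  fix i j assume ij: "1 \<le> i \<and> i \<le> j \<and> j < n"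
  then obtain i' j' where "i = Suc i'" "j = Suc j'"
    by (metis Suc_le_D One_nat_def le_trans)
  thus "a i j \<le> a (i - 1) (j - 1)" "a (i - 1) j \<le> a i j"
    using assms(2,3)[of i' j'] ij by auto
qed (use assms in auto)

lemma add_row_in_gt_patterns:
  assumes dec: "\<And>j. j < n \<Longrightarrow> \<mu> (Suc j) < \<mu> j"
    and \<nu>: "\<nu> \<in> interlacing n \<mu>" and b: "b \<in> gt_patterns n \<nu>"
  shows "add_row n \<mu> b \<in> gt_patterns (Suc n) \<mu>"
proof -
  have sb: "strict_gt_pattern n b" and b0: "\<And>j. j < n \<Longrightarrow> b 0 j = int (\<nu> j)"
    using b by (auto simp: gt_patterns_def)
  have \<nu>b: "\<mu> (Suc j) \<le> \<nu> j" "\<nu> j \<le> \<mu> j" if "j < n" for j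
    using \<nu> that by (auto simp: interlacing_def PiE_iff)
  note D = strict_gt_patternD[OF sb]
  have "strict_gt_pattern (Suc n) (add_row n \<mu> b)"
  proof (rule strict_gt_patternI)
    fix i j assume "\<not> (i \<le> j \<and> j < Suc n)"
    thus "add_row n \<mu> b i j = 0"
      using D(1) by (cases i; cases j) auto
  next
    fix i j assume ij: "i \<le> j" "Suc j < Suc n"
    show "add_row n \<mu> b (Suc i) (Suc j) \<le> add_row n \<mu> b i j"
      using ij D(2) b0 \<nu>b by (cases i; cases j) auto
    show "add_row n \<mu> b i (Suc j) \<le> add_row n \<mu> b (Suc i) (Suc j)"
      using ij D(3) b0 \<nu>b by (cases i; cases j) auto
    show "add_row n \<mu> b i (Suc j) < add_row n \<mu> b i j"
      using ij D(4) dec by (cases i; cases j) auto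
  qed
  thus ?thesis by (simp add: gt_patterns_def)
qed

lemma remove_row:
  assumes a: "a \<in> gt_patterns (Suc n) \<mu>"
  defines "\<nu> \<equiv> restrict (\<lambda>j. nat (a 1 (Suc j))) {..<n}"
  defines "b \<equiv> \<lambda>i j. a (Suc i) (Suc j)"
  shows "\<nu> \<in> interlacing n \<mu>" and "b \<in> gt_patterns n \<nu>" and "add_row n \<mu> b = a"
proof -
  have sa: "strict_gt_pattern (Suc n) a" and a0: "\<And>j. j < Suc n \<Longrightarrow> a 0 j = int (\<mu> j)"
    using a by (auto simp: gt_patterns_def)
  note D = strict_gt_patternD[OF sa]
  have bd: "int (\<mu> (Suc j)) \<le> a 1 (Suc j)" "a 1 (Suc j) \<le> int (\<mu> j)" if "j < n" for j
    using D(2,3)[of 0 j] a0 that by simp_all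
  \<comment> \<open>The lower bound by \<open>\<mu> (Suc j)\<close> makes the entry nonnegative, so
    \<open>nat\<close> loses nothing.\<close>
  have \<nu>: "int (\<nu> j) = a 1 (Suc j)" if "j < n" for j
    using bd(1)[OF that] that by (simp add: \<nu>_def)
  have "\<nu> (Suc j) < \<nu> j" if "Suc j < n" for j
    using D(4)[of 1 "Suc j"] \<nu>[of j] \<nu>[of "Suc j"] that by simp
  moreover have "\<mu> (Suc j) \<le> \<nu> j \<and> \<nu> j \<le> \<mu> j" if "j < n" for j
    using bd[OF that] unfolding \<nu>[OF that, symmetric] by simp
  moreover have "\<nu> \<in> extensional {..<n}"
    by (simp add: \<nu>_def)
  ultimately show "\<nu> \<in> interlacing n \<mu>"
    by (simp add: interlacing_def PiE_iff)
  have "strict_gt_pattern n b"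
    by (rule strict_gt_patternI) (use D in \<open>auto simp: b_def\<close>)
  thus "b \<in> gt_patterns n \<nu>"
    using \<nu> by (simp add: gt_patterns_def b_def)
  show "add_row n \<mu> b = a"
  proof (intro ext)
    fix i j show "add_row n \<mu> b i j = a i j"
      using D(1)[of i j] a0[of j] by (cases i; cases j) (auto simp: b_def add_row_def)
  qed
qed

text \<open>A pattern is recovered from its second row and the subpattern standing on that row, so
  sums over patterns follow the recursion of \<open>gt_sum\<close>.\<close>

lemma bij_betw_add_row:
  assumes dec: "\<And>j. j < n \<Longrightarrow> \<mu> (Suc j) < \<mu> j"
  shows "bij_betw (\<lambda>(\<nu>, b). add_row n \<mu> b) (SIGMA \<nu>:interlacing n \<mu>. gt_patterns n \<nu>)
    (gt_patterns (Suc n) \<mu>)"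
proof (rule bij_betw_byWitness[where f' =
      "\<lambda>a. (restrict (\<lambda>j. nat (a 1 (Suc j))) {..<n}, \<lambda>i j. a (Suc i) (Suc j))"])
  show "\<forall>p\<in>SIGMA \<nu>:interlacing n \<mu>. gt_patterns n \<nu>.
     (restrict (\<lambda>j. nat ((case p of (\<nu>, b) \<Rightarrow> add_row n \<mu> b) 1 (Suc j))) {..<n},
      \<lambda>i j. (case p of (\<nu>, b) \<Rightarrow> add_row n \<mu> b) (Suc i) (Suc j)) = p"
    by (auto simp: gt_patterns_def interlacing_def PiE_iff fun_eq_iff extensional_def)
qed (use remove_row add_row_in_gt_patterns[of n \<mu>, OF dec] in auto)

lemma finite_interlacing: "finite (interlacing n \<mu>)"
  by (rule finite_subset[of _ "PiE {..<n} (\<lambda>j. {\<mu> (Suc j)..\<mu> j})"])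
     (auto simp: interlacing_def intro: finite_PiE)

lemma finite_gt_patterns:
  assumes "\<And>j. Suc j < n \<Longrightarrow> \<mu> (Suc j) < \<mu> j"
  shows "finite (gt_patterns n \<mu>)"
  using assms
proof (induction n arbitrary: \<mu>)
  case 0
  have "gt_patterns 0 \<mu> \<subseteq> {\<lambda>i j. 0}"
    by (auto simp: gt_patterns_def strict_gt_pattern_def)
  thus ?case using finite_subset by blast
next
  case (Suc n)
  have "finite (SIGMA \<nu>:interlacing n \<mu>. gt_patterns n \<nu>)"
    by (intro finite_SigmaI finite_interlacing Suc.IH) (auto simp: interlacing_def)
  thus ?case
    using bij_betw_finite[OF bij_betw_add_row[of n \<mu>]] Suc.prems by simp
qed

section \<open>Pattern weights under removal of the bottom row\<close>

lemma gamma_bar_bottom: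
  assumes "\<mu> 0 < M"
  shows "gamma_bar M t (add_row n \<mu> b) 0 0 = t ^ (M - \<mu> 0 - 1)"
proof -
  have "max (int M - int (\<mu> 0) - 1) 0 = int (M - \<mu> 0 - 1)"
    using assms by simp
  thus ?thesis
    by (simp add: gamma_bar_def entry_def flip: power_int_of_nat)
qed

lemma gamma_bar_bottom_Suc:
  assumes "j < n" "b 0 j = int v"
  shows "gamma_bar M t (add_row n \<mu> b) 0 (Suc j) = t ^ (v - \<mu> (Suc j) - 1)"
proof -
  have "max (int v - int (\<mu> (Suc j)) - 1) 0 = int (v - \<mu> (Suc j) - 1)"
    by simp
  thus ?thesis
    using assms by (simp add: gamma_bar_def entry_def flip: power_int_of_nat)
qed

text \<open>The exponents of t and the convention entries move along the diagonals unchanged. Only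
  the former bottom row, which now has a row beneath it, can acquire a factor
  \<open>t + 1\<close>.\<close>

lemma gamma_bar_add_row_Suc:
  assumes "i \<le> j" "j < n"
  shows "gamma_bar M t (add_row n \<mu> b) (Suc i) (Suc j) =
    (if i = 0 then if b 0 j \<noteq> int (\<mu> (Suc j)) \<and> b 0 j \<noteq> int (\<mu> j) then t + 1 else 1 else 1) *
    gamma_bar M t b i j"
proof (cases i)
  case 0
  thus ?thesis using assms by (auto simp: gamma_bar_def entry_def)
next
  case (Suc i')
  then obtain j' where "j = Suc j'"
    using assms by (cases j) auto
  thus ?thesis using assms Suc by (auto simp: gamma_bar_def entry_def)
qed

text \<open>\<open>G_bar\<close> with half-open ranges: the row above the top one has empty sum, so
  the top row needs no separate factor, and size 0 gives weight 1 as the base of the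
  induction.\<close>

definition pattern_weight ::
    "nat \<Rightarrow> 'a::field \<Rightarrow> (nat \<Rightarrow> 'a) \<Rightarrow> nat \<Rightarrow> (nat \<Rightarrow> nat \<Rightarrow> int) \<Rightarrow> 'a" where
  "pattern_weight M t z n a =
     (\<Prod>i<n. \<Prod>j=i..<n. gamma_bar M t a i j) *
     (\<Prod>i<n. z (n - i) powi ((\<Sum>k=i..<n. a i k) - (\<Sum>k=Suc i..<n. a (Suc i) k)))"

lemma G_bar_eq_pattern_weight:
  assumes "1 \<le> N"
  shows "G_bar N M t z a = pattern_weight M t z N a"
proof -
  obtain n where N: "N = Suc n"
    using assms by (cases N) auto
  have "(\<Prod>i=0..N - 1. \<Prod>j=i..N - 1. gamma_bar M t a i j) =
      (\<Prod>i<N. \<Prod>j=i..<N. gamma_bar M t a i j)"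
    unfolding N lessThan_Suc_atMost atLeastLessThanSuc_atLeastAtMost atLeast0AtMost diff_Suc_1 ..
  thus ?thesis
    unfolding G_bar_def pattern_weight_def
    by (simp add: row_sum_def N atLeastLessThanSuc_atLeastAtMost)
qed

text \<open>The powers of t from the bottom row and the new factors \<open>t + 1\<close> of the row
  above it combine, column by column, to \<open>gt_weight\<close>.\<close>

lemma pattern_weight_add_row:
  fixes t :: "'a::field"
  assumes mu0: "\<mu> 0 < M" and \<nu>: "\<nu> \<in> interlacing n \<mu>" and b: "b \<in> gt_patterns n \<nu>"
  shows "pattern_weight M t z (Suc n) (add_row n \<mu> b) =
     t ^ (M - \<mu> 0 - 1) * (\<Prod>j<n. gt_weight t (\<mu> j) (\<mu> (Suc j)) (\<nu> j)) *
     z (Suc n) ^ (\<mu> n + (\<Sum>j<n. \<mu> j - \<nu> j)) * pattern_weight M t z n b"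
proof -
  let ?a = "add_row n \<mu> b"
  let ?c = "\<lambda>j. if \<nu> j \<noteq> \<mu> (Suc j) \<and> \<nu> j \<noteq> \<mu> j then t + 1 else 1"
  have b0: "b 0 j = int (\<nu> j)" if "j < n" for j
    using b that by (simp add: gt_patterns_def)
  have bottom: "(\<Prod>j=0..<Suc n. gamma_bar M t ?a 0 j) =
      t ^ (M - \<mu> 0 - 1) * (\<Prod>j<n. t ^ (\<nu> j - \<mu> (Suc j) - 1))"
    by (simp only: atLeast0LessThan prod.lessThan_Suc_shift)
       (simp add: gamma_bar_bottom[of \<mu> M, OF mu0] gamma_bar_bottom_Suc b0 del: One_nat_def)
  have row1: "(\<Prod>i<n. \<Prod>j=i..<n. if i = 0 then ?c j else 1) = (\<Prod>j<n. ?c j)"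
  proof (cases n)
    case (Suc m)
    show ?thesis
      unfolding Suc prod.lessThan_Suc_shift[of _ m] atLeast0LessThan
      by (simp only: refl if_True nat.distinct if_False prod.neutral_const mult_1_right
          prod.lessThan_Suc_shift)
  qed simp
  have upper: "(\<Prod>i<n. \<Prod>j=Suc i..<Suc n. gamma_bar M t ?a (Suc i) j) =
      (\<Prod>j<n. ?c j) * (\<Prod>i<n. \<Prod>j=i..<n. gamma_bar M t b i j)"
  proof -
    have "(\<Prod>i<n. \<Prod>j=Suc i..<Suc n. gamma_bar M t ?a (Suc i) j) =
       (\<Prod>i<n. \<Prod>j=i..<n. (if i = 0 then ?c j else 1) * gamma_bar M t b i j)"
      unfolding prod.shift_bounds_Suc_ivl
      by (intro prod.cong refl) (auto simp: gamma_bar_add_row_Suc b0)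
    thus ?thesis by (simp only: prod.distrib row1)
  qed
  have gammas: "(\<Prod>i<Suc n. \<Prod>j=i..<Suc n. gamma_bar M t ?a i j) =
     t ^ (M - \<mu> 0 - 1) * (\<Prod>j<n. gt_weight t (\<mu> j) (\<mu> (Suc j)) (\<nu> j)) *
     (\<Prod>i<n. \<Prod>j=i..<n. gamma_bar M t b i j)"
    unfolding prod.lessThan_Suc_shift bottom upper gt_weight_def prod.distrib by (simp only: mult_ac)
  \<comment> \<open>By interlacing the truncated differences are genuine, so d_0 - d_1 is a natural
    exponent.\<close>
  have "(\<Sum>j<n. int (\<mu> j - \<nu> j)) = (\<Sum>j<n. int (\<mu> j) - int (\<nu> j))"
    using \<nu> by (intro sum.cong) (auto simp: interlacing_def PiE_iff)
  hence "(\<Sum>k=0..<Suc n. ?a 0 k) - (\<Sum>k=0..<n. b 0 k) = int (\<mu> n + (\<Sum>j<n. \<mu> j - \<nu> j))"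
    by (simp add: atLeast0LessThan b0 sum_subtractf)
  moreover have "(\<Sum>k=Suc i..<Suc n. ?a (Suc i) k) = (\<Sum>k=i..<n. b i k)" for i
    unfolding sum.shift_bounds_Suc_ivl by simp
  ultimately have monomial:
    "(\<Prod>i<Suc n. z (Suc n - i) powi ((\<Sum>k=i..<Suc n. ?a i k) - (\<Sum>k=Suc i..<Suc n. ?a (Suc i) k))) =
     z (Suc n) ^ (\<mu> n + (\<Sum>j<n. \<mu> j - \<nu> j)) *
     (\<Prod>i<n. z (n - i) powi ((\<Sum>k=i..<n. b i k) - (\<Sum>k=Suc i..<n. b (Suc i) k)))"
    unfolding prod.lessThan_Suc_shift by (simp only: power_int_of_nat diff_zero diff_Suc_Suc)
  show ?thesis
    unfolding pattern_weight_def gammas monomial by (simp only: mult_ac)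
qed

lemma sum_pattern_weight:
  fixes t :: "'a::field"
  assumes "t \<noteq> 0" and "\<And>j. Suc j < n \<Longrightarrow> \<mu> (Suc j) < \<mu> j" and "0 < n \<Longrightarrow> \<mu> 0 < M"
  shows "(\<Sum>a\<in>gt_patterns n \<mu>. pattern_weight M t z n a) = gt_sum t M (\<lambda>i. z (Suc i) / t) n \<mu>"
  using assms(2,3)
proof (induction n arbitrary: \<mu>)
  case 0
  have "gt_patterns 0 \<mu> = {\<lambda>i j. 0}"
    by (auto simp: gt_patterns_def strict_gt_pattern_def)
  thus ?case by (simp add: pattern_weight_def)
next
  case (Suc n)
  have dec: "\<mu> (Suc j) < \<mu> j" if "j < n" for j
    using Suc.prems that by simp
  have mu0: "\<mu> 0 < M"
    using Suc.prems by simp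
  have IH: "(\<Sum>b\<in>gt_patterns n \<nu>. pattern_weight M t z n b) = gt_sum t M (\<lambda>i. z (Suc i) / t) n \<nu>"
    if "\<nu> \<in> interlacing n \<mu>" for \<nu>
  proof (rule Suc.IH)
    assume "0 < n"
    hence "\<nu> 0 \<le> \<mu> 0" using that by (auto simp: interlacing_def PiE_iff)
    thus "\<nu> 0 < M" using mu0 by simp
  qed (use that in \<open>auto simp: interlacing_def\<close>)
  have fin: "finite (gt_patterns n \<nu>)" if "\<nu> \<in> interlacing n \<mu>" for \<nu>
    using that by (intro finite_gt_patterns) (auto simp: interlacing_def)
  have "(\<Sum>a\<in>gt_patterns (Suc n) \<mu>. pattern_weight M t z (Suc n) a) =
     (\<Sum>(\<nu>, b)\<in>(SIGMA \<nu>:interlacing n \<mu>. gt_patterns n \<nu>). pattern_weight M t z (Suc n) (add_row n \<mu> b))"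
    by (subst sum.reindex_bij_betw[OF bij_betw_add_row[of n \<mu>, OF dec], symmetric])
       (simp_all add: case_prod_beta)
  also have "\<dots> = (\<Sum>\<nu>\<in>interlacing n \<mu>. \<Sum>b\<in>gt_patterns n \<nu>. pattern_weight M t z (Suc n) (add_row n \<mu> b))"
    using fin by (subst sum.Sigma) (auto simp: finite_interlacing)
  also have "\<dots> = gt_sum t M (\<lambda>i. z (Suc i) / t) (Suc n) \<mu>"
    \<comment> \<open>Since \<open>t \<noteq> 0\<close>, the scaled variable satisfies
      \<open>t * (z (Suc n) / t) = z (Suc n)\<close>.\<close>
    using assms(1) by (simp add: pattern_weight_add_row[of \<mu> M, OF mu0] IH flip: sum_distrib_left)
  finally show ?case .
qed

section \<open>Evaluation as a ring homomorphism\<close>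

lemma eval_mpoly_superset:
  assumes "finite A" "Poly_Mapping.keys p \<subseteq> A"
  shows "eval_mpoly z p =
    (\<Sum>m\<in>A. Poly_Mapping.lookup p m * (\<Prod>i\<in>Poly_Mapping.keys m. z i ^ Poly_Mapping.lookup m i))"
  unfolding eval_mpoly_def using assms
  by (intro sum.mono_neutral_left) (auto simp: in_keys_iff)

lemma eval_mpoly_single:
  "eval_mpoly z (Poly_Mapping.single m c) = c * (\<Prod>i\<in>Poly_Mapping.keys m. z i ^ Poly_Mapping.lookup m i)"
  by (subst eval_mpoly_superset[of "{m}"]) auto

lemma eval_mpoly_add: "eval_mpoly z (p + q) = eval_mpoly z p + eval_mpoly z q"
proof -
  let ?A = "Poly_Mapping.keys p \<union> Poly_Mapping.keys q"
  have "Poly_Mapping.keys (p + q) \<subseteq> ?A"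
    by (rule keys_add)
  thus ?thesis
    by (subst (1 2 3) eval_mpoly_superset[of ?A]) (auto simp: lookup_add sum.distrib distrib_right)
qed

lemma eval_mpoly_zero: "eval_mpoly z 0 = 0"
  by (simp add: eval_mpoly_def)

lemma eval_mpoly_sum: "eval_mpoly z (\<Sum>x\<in>A. f x) = (\<Sum>x\<in>A. eval_mpoly z (f x))"
  by (induction A rule: infinite_finite_induct) (simp_all add: eval_mpoly_add eval_mpoly_zero)

lemma prod_powers_keys_add:
  fixes z :: "nat \<Rightarrow> 'a::comm_ring_1" and m k :: "nat \<Rightarrow>\<^sub>0 nat"
  shows "(\<Prod>i\<in>Poly_Mapping.keys (m + k). z i ^ Poly_Mapping.lookup (m + k) i) =
     (\<Prod>i\<in>Poly_Mapping.keys m. z i ^ Poly_Mapping.lookup m i) *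
     (\<Prod>i\<in>Poly_Mapping.keys k. z i ^ Poly_Mapping.lookup k i)"
proof -
  let ?A = "Poly_Mapping.keys m \<union> Poly_Mapping.keys k"
  have *: "(\<Prod>i\<in>Poly_Mapping.keys p. z i ^ Poly_Mapping.lookup p i) =
      (\<Prod>i\<in>?A. z i ^ Poly_Mapping.lookup p i)" if "Poly_Mapping.keys p \<subseteq> ?A" for p :: "nat \<Rightarrow>\<^sub>0 nat"
    using that by (intro prod.mono_neutral_left) (auto simp: in_keys_iff)
  show ?thesis
    unfolding *[OF keys_add] *[OF Un_upper1] *[OF Un_upper2]
    by (simp add: lookup_add power_add prod.distrib)
qed

lemma poly_mapping_sum_singles:
  fixes p :: "'b \<Rightarrow>\<^sub>0 'a::comm_monoid_add"
  shows "p = (\<Sum>m\<in>Poly_Mapping.keys p. Poly_Mapping.single m (Poly_Mapping.lookup p m))"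
  by (rule poly_mapping_eqI) (auto simp: lookup_sum lookup_single when_def in_keys_iff)

text \<open>Both factors are split into monomials, where multiplicativity is a matter of adding
  exponents; the support of \<open>p * q\<close>, which may shrink by cancellation, never
  enters.\<close>

lemma eval_mpoly_mult: "eval_mpoly z (p * q) = eval_mpoly z p * eval_mpoly z q"
proof -
  let ?s = "\<lambda>p m. Poly_Mapping.single m (Poly_Mapping.lookup p m)"
  have "eval_mpoly z (p * q) =
     eval_mpoly z ((\<Sum>m\<in>Poly_Mapping.keys p. ?s p m) * (\<Sum>m\<in>Poly_Mapping.keys q. ?s q m))"
    by (simp flip: poly_mapping_sum_singles)
  also have "\<dots> = eval_mpoly z p * eval_mpoly z q"
    by (simp add: sum_product mult_single eval_mpoly_sum eval_mpoly_single prod_powers_keys_add)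
       (simp add: eval_mpoly_def sum_product mult_ac)
  finally show ?thesis .
qed

lemma eval_mpoly_one: "eval_mpoly z 1 = 1"
  using eval_mpoly_single[of z 0 1] by simp

lemma eval_mpoly_var: "eval_mpoly z (var i) = z i"
  by (simp add: var_def eval_mpoly_single)

interpretation eval_mpoly: comm_ring_hom "eval_mpoly z"
  by unfold_locales (simp_all add: eval_mpoly_add eval_mpoly_mult eval_mpoly_one eval_mpoly_zero)

lemma (in comm_ring_hom) hom_gt_weight: "hom (gt_weight t a b v) = gt_weight (hom t) a b v"
  by (simp add: gt_weight_def hom_power hom_mult hom_add)

text \<open>\<open>gt_sum\<close> uses ring operations only; this carries the identity from
  indeterminates to field elements.\<close>

lemma (in comm_ring_hom) hom_gt_sum:
  "hom (gt_sum t M x n \<mu>) = gt_sum (hom t) M (\<lambda>i. hom (x i)) n \<mu>"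
  by (induction n arbitrary: \<mu>) (simp_all add: hom_sum hom_prod hom_power hom_mult hom_gt_weight)

section \<open>Schur polynomials and specialization\<close>

lemma var_eq_iff: "(var i :: 'a::comm_ring_1 mpoly) = var j \<longleftrightarrow> i = j"
proof
  assume "(var i :: 'a mpoly) = var j"
  hence "Poly_Mapping.lookup (var i :: 'a mpoly) (Poly_Mapping.single j 1) = 1"
    by (simp add: var_def)
  hence "Poly_Mapping.single i (1::nat) = Poly_Mapping.single j 1"
    by (auto simp: var_def lookup_single when_def split: if_splits)
  hence "Poly_Mapping.lookup (Poly_Mapping.single i (1::nat)) j = 1"
    by simp
  thus "i = j"
    by (auto simp: lookup_single when_def split: if_splits)
qed simp

lemma vandermonde_var_neq_0: "vandermonde n (\<lambda>i. var (Suc i) :: 'a::field mpoly) \<noteq> 0"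
  by (auto simp: vandermonde_def var_eq_iff)

lemma prod_pairs_shift:
  "(\<Prod>k=1..N. \<Prod>j=1..<k. f j k) = (\<Prod>k<N. \<Prod>j<k. f (Suc j) (Suc k))"
  by (simp add: prod.atLeast1_atMost_eq atLeastLessThanSuc_atLeastAtMost)

text \<open>The definite description is met: a quotient exists by divisibility, and it is unique
  because the Vandermonde product of distinct variables is nonzero in an integral domain.\<close>

lemma schur_mult_vandermonde:
  assumes "young_diagram N lam"
  defines "X \<equiv> \<lambda>i. var (Suc i) :: 'a::field mpoly"
  shows "schur N lam * vandermonde N X = alternant N X (\<lambda>j. lam (Suc j) + (N - Suc j))"
proof -
  let ?A = "alternant N X (\<lambda>j. lam (Suc j) + (N - Suc j))"
  have nz: "vandermonde N X \<noteq> 0"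
    unfolding X_def by (rule vandermonde_var_neq_0)
  have "vandermonde N X dvd ?A"
    using assms(1) by (intro vandermonde_dvd_alternant add_mono) (auto simp: young_diagram_def)
  then obtain s where s: "s * vandermonde N X = ?A"
    by (metis dvd_def mult.commute)
  have "schur N lam = (THE s. s * vandermonde N X = ?A)"
    unfolding schur_def vandermonde_def alternant_def X_def prod_pairs_shift ..
  also have "\<dots> = s"
    using s nz by (intro the_equality) (auto simp flip: s)
  finally show ?thesis using s by simp
qed

theorem theorem6p2:
  fixes N M :: nat and lam :: "nat \<Rightarrow> nat" and z :: "nat \<Rightarrow> 'a::field" and t :: 'a
  assumes "1 \<le> N" and "N \<le> M"
    and "young_diagram N lam" and "lam 1 \<le> M - N"
    and "t \<noteq> 0"
  shows "t ^ (N * (M - N)) * (\<Prod>k=1..N. \<Prod>j=1..<k. z j + t * z k) *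
           eval_mpoly (\<lambda>j. z j / t) (schur N lam) =
         (\<Sum>a\<in>strict_gt_patterns N lam. G_bar N M t z a)"
proof -
  define \<mu> where "\<mu> = (\<lambda>j. lam (Suc j) + (N - Suc j))"
  \<comment> \<open>The parameter t enters the polynomial ring as a constant.\<close>
  define T :: "'a mpoly" where "T = Poly_Mapping.single 0 t"
  define X :: "nat \<Rightarrow> 'a mpoly" where "X = (\<lambda>i. var (Suc i))"
  define P where "P = (\<Prod>k<N. \<Prod>j<k. T * X j + T * (T * X k))"
  let ?e = "eval_mpoly (\<lambda>j. z j / t)"
  \<comment> \<open>The parts decrease weakly and the staircase \<open>N - Suc j\<close>
    strictly.\<close>
  have dec: "\<mu> (Suc j) < \<mu> j" if "Suc j < N" for j
    unfolding \<mu>_def using assms(3) that by (intro add_le_less_mono) (auto simp: young_diagram_def)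
  have mu0: "\<mu> 0 < M"
    using assms(1,2,4) by (simp add: \<mu>_def)
  have eT: "?e T = t"
    by (simp add: T_def eval_mpoly_single)
  have eX: "?e (X i) = z (Suc i) / t" for i
    by (simp add: X_def eval_mpoly_var)
  have "vandermonde N X * gt_sum T M X N \<mu> = T ^ (N * (M - N)) * P * alternant N X \<mu>"
    unfolding P_def by (rule vandermonde_gt_sum[OF assms(2) dec mu0])
  also have "alternant N X \<mu> = schur N lam * vandermonde N X"
    unfolding X_def \<mu>_def by (rule schur_mult_vandermonde[OF assms(3), symmetric])
  also have "T ^ (N * (M - N)) * P * (schur N lam * vandermonde N X) =
      vandermonde N X * (T ^ (N * (M - N)) * P * schur N lam)"
    by (simp only: mult_ac)
  finally have "gt_sum T M X N \<mu> = T ^ (N * (M - N)) * P * schur N lam"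
    unfolding X_def using vandermonde_var_neq_0[where 'a = 'a] by (metis mult_cancel_left)
  hence "?e (gt_sum T M X N \<mu>) = ?e (T ^ (N * (M - N)) * P * schur N lam)"
    by simp
  hence "gt_sum t M (\<lambda>i. z (Suc i) / t) N \<mu> =
      t ^ (N * (M - N)) * (\<Prod>k<N. \<Prod>j<k. z (Suc j) + t * z (Suc k)) * ?e (schur N lam)"
    using assms(5)
    by (simp add: eval_mpoly.hom_gt_sum eval_mpoly.hom_prod eval_mpoly.hom_power
        eval_mpoly.hom_mult eval_mpoly.hom_add eT eX P_def)
  moreover have "strict_gt_patterns N lam = gt_patterns N \<mu>"
    by (auto simp: strict_gt_patterns_def gt_patterns_def \<mu>_def of_nat_diff)
  hence "(\<Sum>a\<in>strict_gt_patterns N lam. G_bar N M t z a) =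
      gt_sum t M (\<lambda>i. z (Suc i) / t) N \<mu>"
    using sum_pattern_weight[where z = z and n = N and \<mu> = \<mu>, OF assms(5) dec mu0]
    by (simp add: G_bar_eq_pattern_weight[OF assms(1)])
  ultimately show ?thesis
    unfolding prod_pairs_shift by simp
qed

end
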